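(* Let $H$ be a program hyperproperty, i.e. a set of sets of pairs of program states. Assume that the cardinality of $\mathit{LVars}$ is at least the cardinality of $\mathit{PVars}$ and that the cardinality of $\mathit{LVals}$ is at least the cardinality of $\mathit{PVals}$. Then there exist hyper-assertions $P$ and $Q$ such that, for every command $C$, $C$ satisfies $H$ if and only if $\models\{P\}C\{Q\}$.
   Context: Fix sets $\mathit{PVars}$, $\mathit{PVals}$ (program variables and values) and $\mathit{LVars}$, $\mathit{LVals}$ (logical variables and values). Program states are total functions $\sigma:\mathit{PVars}\to\mathit{PVals}$. Commands: $C ::= \mathbf{skip} \mid x:=e \mid x:=\mathrm{nonDet}() \mid \mathbf{assume}\ b \mid C;C \mid C+C \mid C^{*}$, with $x\in\mathit{PVars}$, $e$ a total function from program states to $\mathit{PVals}$, $b$ a total function from program states to Booleans. Big-step semantics $\langle C,\sigma\rangle\to\sigma'$ (inductive): $\langle\mathbf{skip},\sigma\rangle\to\sigma$; $\langle x:=e,\sigma\rangle\to\sigma[x\mapsto e(\sigma)]$; $\langle x:=\mathrm{nonDet}(),\sigma\rangle\to\sigma[x\mapsto v]$ for all $v$; $\langle\mathbf{assume}\ b,\sigma\rangle\to\sigma$ if $b(\sigma)$; sequential composition composes executions; $C_1+C_2$ executes either branch; $\langle C^*,\sigma\rangle\to\sigma$, and $\langle C^*,\sigma\rangle\to\sigma''$ whenever $\langle C,\sigma\rangle\to\sigma'$ and $\langle C^*,\sigma'\rangle\to\sigma''$. Extended states are pairs $\varphi=(\varphi^L,\varphi^P)$ with $\varphi^L:\mathit{LVars}\to\mathit{LVals}$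 and $\varphi^P$ a program state; $\mathit{sem}(C,S)=\{\varphi\mid\exists\sigma.(\varphi^L,\sigma)\in S\wedge\langle C,\sigma\rangle\to\varphi^P\}$. A hyper-assertion is a function from sets of extended states to Booleans; $\models\{P\}C\{Q\}$ iff for all sets $S$ of extended states, $P(S)$ implies $Q(\mathit{sem}(C,S))$. A program hyperproperty is an element of $\mathcal P(\mathcal P(\mathit{PStates}\times\mathit{PStates}))$; a command $C$ satisfies $H$ iff $\{(\sigma,\sigma')\mid\langle C,\sigma\rangle\to\sigma'\}\in H$. *)

theory Defs
  imports Main "HOL-Library.Equipollence"
begin

(* The sets PVars, PVals, LVars, LVals are the type variables 'pvar, 'pval, 'lvar, 'lval. *)

type_synonym ('pvar, 'pval) pstate = "'pvar \<Rightarrow> 'pval"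

datatype ('pvar, 'pval) cmd =
    Skip
  | Assign 'pvar "('pvar, 'pval) pstate \<Rightarrow> 'pval"
  | NonDet 'pvar
  | Assume "('pvar, 'pval) pstate \<Rightarrow> bool"
  | Seq "('pvar, 'pval) cmd" "('pvar, 'pval) cmd"
  | Choice "('pvar, 'pval) cmd" "('pvar, 'pval) cmd"
  | Iter "('pvar, 'pval) cmd"

inductive big_step ::
    "('pvar, 'pval) cmd \<Rightarrow> ('pvar, 'pval) pstate \<Rightarrow> ('pvar, 'pval) pstate \<Rightarrow> bool"
  where
    Skip: "big_step Skip \<sigma> \<sigma>"
  | Assign: "big_step (Assign x e) \<sigma> (\<sigma>(x := e \<sigma>))"
  | NonDet: "big_step (NonDet x) \<sigma> (\<sigma>(x := v))"
  | Assume: "b \<sigma> \<Longrightarrow> big_step (Assume b) \<sigma> \<sigma>"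
  | Seq: "big_step C1 \<sigma> \<sigma>' \<Longrightarrow> big_step C2 \<sigma>' \<sigma>'' \<Longrightarrow> big_step (Seq C1 C2) \<sigma> \<sigma>''"
  | Choice1: "big_step C1 \<sigma> \<sigma>' \<Longrightarrow> big_step (Choice C1 C2) \<sigma> \<sigma>'"
  | Choice2: "big_step C2 \<sigma> \<sigma>' \<Longrightarrow> big_step (Choice C1 C2) \<sigma> \<sigma>'"
  | IterZero: "big_step (Iter C) \<sigma> \<sigma>"
  | IterStep: "big_step C \<sigma> \<sigma>' \<Longrightarrow> big_step (Iter C) \<sigma>' \<sigma>'' \<Longrightarrow> big_step (Iter C) \<sigma> \<sigma>''"

type_synonym ('lvar, 'lval, 'pvar, 'pval) ext_state =
  "('lvar \<Rightarrow> 'lval) \<times> ('pvar, 'pval) pstate"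

type_synonym ('lvar, 'lval, 'pvar, 'pval) hyper_assertion =
  "('lvar, 'lval, 'pvar, 'pval) ext_state set \<Rightarrow> bool"

type_synonym ('pvar, 'pval) hyperproperty =
  "(('pvar, 'pval) pstate \<times> ('pvar, 'pval) pstate) set set"

definition sem ::
    "('pvar, 'pval) cmd \<Rightarrow> ('lvar, 'lval, 'pvar, 'pval) ext_state set
      \<Rightarrow> ('lvar, 'lval, 'pvar, 'pval) ext_state set"
  where "sem C S = {\<phi>. \<exists>\<sigma>. (fst \<phi>, \<sigma>) \<in> S \<and> big_step C \<sigma> (snd \<phi>)}"

definition hyper_valid ::
    "('lvar, 'lval, 'pvar, 'pval) hyper_assertion \<Rightarrow> ('pvar, 'pval) cmd
      \<Rightarrow> ('lvar, 'lval, 'pvar, 'pval) hyper_assertion \<Rightarrow> bool"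
  where "hyper_valid P C Q \<longleftrightarrow> (\<forall>S. P S \<longrightarrow> Q (sem C S))"

definition satisfies :: "('pvar, 'pval) cmd \<Rightarrow> ('pvar, 'pval) hyperproperty \<Rightarrow> bool"
  where "satisfies C H \<longleftrightarrow> {(\<sigma>, \<sigma>'). big_step C \<sigma> \<sigma>'} \<in> H"

end

theory Submission
  imports Defs
begin

text \<open>Because there are at least as many logical as program variables and values, a program state
  can be stored injectively in a logical state. The precondition asserts that the set of states
  consists of all program states, each paired with its own encoding; since execution preserves
  logical states, the set after execution determines the whole input-output relation, and the
  postcondition asserts that this relation is in the hyperproperty.\<close>

lemma ex_inj_fun_encoding:
  assumes "(UNIV :: 'a set) \<lesssim> (UNIV :: 'c set)"
    and "(UNIV :: 'b set) \<lesssim> (UNIV :: 'd set)"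
  shows "\<exists>enc :: ('a \<Rightarrow> 'b) \<Rightarrow> ('c \<Rightarrow> 'd). inj enc"
proof -
  obtain f :: "'a \<Rightarrow> 'c" and g :: "'b \<Rightarrow> 'd" where f: "inj f" and g: "inj g"
    using assms unfolding lepoll_def by blast
  \<comment> \<open>Since \<open>inv f\<close> is a left inverse of \<open>f\<close>, the encoded
    state takes the value \<open>g (\<sigma> x)\<close> at \<open>f x\<close>, which determines
    \<open>\<sigma> x\<close>.\<close>
  have "inj (\<lambda>\<sigma>. g \<circ> \<sigma> \<circ> inv f)"
  proof (rule injI, rule ext)
    fix \<sigma> \<tau> x
    assume "g \<circ> \<sigma> \<circ> inv f = g \<circ> \<tau> \<circ> inv f"
    then have "(g \<circ> \<sigma> \<circ> inv f) (f x) = (g \<circ> \<tau> \<circ> inv f) (f x)"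
      by simp
    then show "\<sigma> x = \<tau> x"
      using f g by (simp add: inj_eq)
  qed
  then show ?thesis by blast
qed

text \<open>Injectivity makes \<open>\<sigma>\<close> the only program state tagged with
  \<open>enc \<sigma>\<close>, so it is the only possible initial state.\<close>

lemma sem_range_encoding_iff:
  assumes "inj enc"
  shows "(enc \<sigma>, \<sigma>') \<in> sem C (range (\<lambda>\<sigma>. (enc \<sigma>, \<sigma>))) \<longleftrightarrow> big_step C \<sigma> \<sigma>'"
  using assms by (auto simp: sem_def dest: injD)

theorem mainTheorem4:
  fixes H :: "('pvar, 'pval) hyperproperty"
  assumes "(UNIV :: 'pvar set) \<lesssim> (UNIV :: 'lvar set)"
    and "(UNIV :: 'pval set) \<lesssim> (UNIV :: 'lval set)"
  shows "\<exists>(P :: ('lvar, 'lval, 'pvar, 'pval) hyper_assertion)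
           (Q :: ('lvar, 'lval, 'pvar, 'pval) hyper_assertion).
           \<forall>C :: ('pvar, 'pval) cmd. satisfies C H \<longleftrightarrow> hyper_valid P C Q"
proof -
  obtain enc :: "('pvar \<Rightarrow> 'pval) \<Rightarrow> ('lvar \<Rightarrow> 'lval)" where enc: "inj enc"
    using ex_inj_fun_encoding[OF assms] by blast
  let ?P = "\<lambda>S. S = range (\<lambda>\<sigma>. (enc \<sigma>, \<sigma>))"
  let ?Q = "\<lambda>S. {(\<sigma>, \<sigma>'). (enc \<sigma>, \<sigma>') \<in> S} \<in> H"
  \<comment> \<open>Exactly one set satisfies \<open>?P\<close>, so validity reduces to
    \<open>?Q\<close> of its image under \<open>sem C\<close>.\<close>
  have "\<forall>C. satisfies C H \<longleftrightarrow> hyper_valid ?P C ?Q"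
    by (simp add: satisfies_def hyper_valid_def sem_range_encoding_iff[OF enc])
  then show ?thesis
    by blast
qed

end
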